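(* Let $A=(a_{ij})$ and $B=(b_{ij})$ be orthogonal Latin squares of order $n$ such that the sum of the main diagonal of each of $A$ and $B$ is $n(n+1)/2$ and the sum of the antidiagonal of each of $A$ and $B$ is $n(n+1)/2$; that is, $\sum_{i=1}^n a_{ii}=\sum_{i=1}^n b_{ii}=\sum_{i=1}^n a_{i(n+1-i)}=\sum_{i=1}^n b_{i(n+1-i)}=\frac{n(n+1)}{2}$. Then $A +_S B$ is a magic square of order $n$.
   Context: A Latin square of order $n$ is an $n\times n$ array with entries in $\{1,\dots,n\}$ in which each symbol occurs exactly once in each row and each column. Two Latin squares $(a_{ij})$, $(b_{ij})$ of order $n$ are orthogonal if the $n^2$ ordered pairs $(a_{ij},b_{ij})$ are all distinct. For orthogonal Latin squares $A=(a_{ij})$, $B=(b_{ij})$ of order $n$, $A+_S B$ denotes the $n\times n$ square with $(i,j)$ entry $n(a_{ij}-1)+b_{ij}$. A magic square of order $n$ is an $n\times n$ array containing $n^2$ consecutive integers (each exactly once; here $1,2,\dots,n^2$) such that the sums of each row, each column, the main diagonal, and the antidiagonal are all the same. *)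

theory Defs
  imports Main
begin

text \<open>
  A square array of order \<open>n\<close> is a function of a row and a column index, both ranging over
  \<open>{1..n}\<close>; values outside this range are irrelevant. Entries are integers, so that
  subtraction is not truncated.
\<close>

type_synonym square = "nat \<Rightarrow> nat \<Rightarrow> int"

definition latin_square :: "nat \<Rightarrow> square \<Rightarrow> bool" where
  "latin_square n L \<longleftrightarrow>
     (\<forall>i\<in>{1..n}. \<forall>j\<in>{1..n}. L i j \<in> {1..int n}) \<and>
     (\<forall>i\<in>{1..n}. \<forall>s\<in>{1..int n}. \<exists>!j. j \<in> {1..n} \<and> L i j = s) \<and>
     (\<forall>j\<in>{1..n}. \<forall>s\<in>{1..int n}. \<exists>!i. i \<in> {1..n} \<and> L i j = s)"

definition orthogonal_latin_squares :: "nat \<Rightarrow> square \<Rightarrow> square \<Rightarrow> bool" where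
  "orthogonal_latin_squares n A B \<longleftrightarrow>
     latin_square n A \<and> latin_square n B \<and>
     inj_on (\<lambda>(i, j). (A i j, B i j)) ({1..n} \<times> {1..n})"

definition row_sum :: "nat \<Rightarrow> square \<Rightarrow> nat \<Rightarrow> int" where
  "row_sum n M i = (\<Sum>j = 1..n. M i j)"

definition col_sum :: "nat \<Rightarrow> square \<Rightarrow> nat \<Rightarrow> int" where
  "col_sum n M j = (\<Sum>i = 1..n. M i j)"

definition diag_sum :: "nat \<Rightarrow> square \<Rightarrow> int" where
  "diag_sum n M = (\<Sum>i = 1..n. M i i)"

definition antidiag_sum :: "nat \<Rightarrow> square \<Rightarrow> int" where
  "antidiag_sum n M = (\<Sum>i = 1..n. M i (n + 1 - i))"

definition square_sum :: "nat \<Rightarrow> square \<Rightarrow> square \<Rightarrow> square" where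
  "square_sum n A B = (\<lambda>i j. int n * (A i j - 1) + B i j)"

text \<open>The consecutive integers are normalised to \<open>1, \<dots>, n\<^sup>2\<close>.\<close>

definition magic_square :: "nat \<Rightarrow> square \<Rightarrow> bool" where
  "magic_square n M \<longleftrightarrow>
     bij_betw (\<lambda>(i, j). M i j) ({1..n} \<times> {1..n}) {1..(int n)\<^sup>2} \<and>
     (\<exists>s. (\<forall>i\<in>{1..n}. row_sum n M i = s) \<and>
          (\<forall>j\<in>{1..n}. col_sum n M j = s) \<and>
          diag_sum n M = s \<and>
          antidiag_sum n M = s)"

end

theory Submission
  imports Defs
begin

text \<open>Each entry of the combined square, lowered by 1, is
  \<open>n * (a - 1) + (b - 1)\<close>: a two-digit number in base \<open>n\<close> with digits
  \<open>a - 1\<close> and \<open>b - 1\<close>. Distinct digit pairs give distinct numbers, so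
  orthogonality makes the entries distinct, and counting shows that they fill 1 to the square of
  \<open>n\<close> (\<open>square_sum_bij\<close>). Summing over any \<open>n\<close> cells turns
  line sums \<open>p\<close> of \<open>A\<close> and \<open>q\<close> of \<open>B\<close> into
  \<open>n * (p - n) + q\<close>. Rows and columns of a Latin square are permutations of 1, ...,
  \<open>n\<close> (\<open>latin_square_row_sum\<close>, \<open>latin_square_col_sum\<close>), and
  the diagonals have the same sum by hypothesis, so all lines agree.\<close>

lemma sum_ints_upto: "(\<Sum>s = 1..int n. s) = int n * (int n + 1) div 2"
proof -
  have "(\<Sum>s = 1..int n. s) = (\<Sum>k = 1..n. int k)"
    by (rule sum.reindex_bij_witness[where i = int and j = nat]) auto
  also have "\<dots> = int n * (int n + 1) div 2"
    using gauss_sum_from_Suc_0[where 'a = int, of n] by simp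
  finally show ?thesis .
qed

lemma latin_square_entry:
  assumes "latin_square n L" "i \<in> {1..n}" "j \<in> {1..n}"
  shows "1 \<le> L i j" "L i j \<le> int n"
  using assms by (auto simp: latin_square_def)

text \<open>A row is a bijection from its positions onto the symbols, so its sum is that of 1, ...,
  \<open>n\<close> reordered.\<close>

lemma latin_square_row_sum:
  assumes "latin_square n L" "i \<in> {1..n}"
  shows "row_sum n L i = int n * (int n + 1) div 2"
proof -
  have "bij_betw (\<lambda>j. L i j) {1..n} {1..int n}"
  proof (rule bij_betwI')
    fix j k assume jk: "j \<in> {1..n}" "k \<in> {1..n}"
    have "L i j \<in> {1..int n}"
      using assms jk by (simp add: latin_square_def)
    \<comment> \<open>Injectivity comes from the uniqueness clause, applied to the symbol that
      stands in column \<open>j\<close>.\<close>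
    then have "\<exists>!j'. j' \<in> {1..n} \<and> L i j' = L i j"
      using assms unfolding latin_square_def by blast
    with jk show "L i j = L i k \<longleftrightarrow> j = k"
      by metis
  next
    fix j assume "j \<in> {1..n}"
    with assms show "L i j \<in> {1..int n}"
      by (simp add: latin_square_def)
  next
    fix s assume "s \<in> {1..int n}"
    with assms have "\<exists>!j. j \<in> {1..n} \<and> L i j = s"
      unfolding latin_square_def by blast
    then show "\<exists>j\<in>{1..n}. s = L i j"
      by blast
  qed
  then show ?thesis
    unfolding row_sum_def sum_ints_upto[symmetric]
    by (rule sum.reindex_bij_betw[where g = "\<lambda>s. s"])
qed

text \<open>The transpose of a Latin square is Latin, which reduces columns to rows.\<close>

lemma latin_square_col_sum:
  assumes "latin_square n L" "j \<in> {1..n}"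
  shows "col_sum n L j = int n * (int n + 1) div 2"
proof -
  have "latin_square n (\<lambda>i j. L j i)"
    using assms(1) unfolding latin_square_def by auto
  from latin_square_row_sum[OF this assms(2)] show ?thesis
    by (simp add: row_sum_def col_sum_def)
qed

text \<open>Uniqueness of division with remainder: after subtracting 1, the remainder
  \<open>b - 1\<close> lies between 0 and \<open>m - 1\<close>, so division by \<open>m\<close>
  recovers \<open>a - 1\<close>, and then \<open>b\<close> follows by cancellation.\<close>

lemma base_digits_unique:
  fixes m a b a' b' :: int
  assumes "m * (a - 1) + b = m * (a' - 1) + b'"
    and "1 \<le> b" "b \<le> m" "1 \<le> b'" "b' \<le> m"
  shows "a = a' \<and> b = b'"
proof -
  have digits: "(m * (x - 1) + y - 1) div m = x - 1"
    if "1 \<le> y" "y \<le> m" for x y :: int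
    using that by (intro int_div_pos_eq[where r = "y - 1"]) auto
  have "a = a'"
    using digits[of b a] digits[of b' a'] assms by simp
  with assms show ?thesis by simp
qed

lemma square_sum_bij:
  assumes "orthogonal_latin_squares n A B"
  shows "bij_betw (\<lambda>(i, j). square_sum n A B i j) ({1..n} \<times> {1..n}) {1..(int n)\<^sup>2}"
proof -
  let ?S = "{1..n} \<times> {1..n}"
  let ?f = "\<lambda>(i, j). square_sum n A B i j"
  from assms have A: "latin_square n A" and B: "latin_square n B"
    and inj: "inj_on (\<lambda>(i, j). (A i j, B i j)) ?S"
    by (auto simp: orthogonal_latin_squares_def)
  note entries = latin_square_entry[OF A] latin_square_entry[OF B]
  have inj_f: "inj_on ?f ?S"
  proof (rule inj_onI)
    fix p q assume pq: "p \<in> ?S" "q \<in> ?S" "?f p = ?f q"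
    obtain i j k l where eq: "p = (i, j)" "q = (k, l)" by (cases p, cases q)
    have "A i j = A k l \<and> B i j = B k l"
      by (rule base_digits_unique[of "int n"])
        (use pq eq entries in \<open>auto simp: square_sum_def\<close>)
    then show "p = q"
      using inj_onD[OF inj, of p q] pq eq by simp
  qed
  have "?f ` ?S \<subseteq> {1..(int n)\<^sup>2}"
  proof clarify
    fix i j assume ij: "i \<in> {1..n}" "j \<in> {1..n}"
    have "0 \<le> int n * (A i j - 1)" "int n * (A i j - 1) \<le> int n * (int n - 1)"
      using entries[OF ij] by (auto intro: mult_left_mono)
    then have "1 \<le> square_sum n A B i j" "square_sum n A B i j \<le> int n * (int n - 1) + int n"
      using entries(3,4)[OF ij] unfolding square_sum_def by linarith+
    then show "square_sum n A B i j \<in> {1..(int n)\<^sup>2}"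
      by (simp add: power2_eq_square right_diff_distrib)
  qed
  \<comment> \<open>Surjectivity by counting: an injective image of all the cells has as many
    elements as the finite target that contains it.\<close>
  moreover have "card (?f ` ?S) = card {1..(int n)\<^sup>2}"
    using inj_f by (simp add: card_image card_cartesian_product power2_eq_square nat_mult_distrib)
  ultimately have "?f ` ?S = {1..(int n)\<^sup>2}"
    by (intro card_subset_eq) auto
  with inj_f show ?thesis
    by (rule bij_betw_imageI)
qed

theorem theorem4p2:
  fixes n :: nat and A B :: square
  assumes "orthogonal_latin_squares n A B"
    and "diag_sum n A = int n * (int n + 1) div 2"
    and "diag_sum n B = int n * (int n + 1) div 2"
    and "antidiag_sum n A = int n * (int n + 1) div 2"
    and "antidiag_sum n B = int n * (int n + 1) div 2"
  shows "magic_square n (square_sum n A B)"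
proof -
  from assms(1) have latin: "latin_square n A" "latin_square n B"
    by (auto simp: orthogonal_latin_squares_def)
  let ?c = "int n * (int n + 1) div 2"
  let ?s = "int n * (?c - int n) + ?c"
  \<comment> \<open>One identity serves rows, columns and both diagonals, since \<open>f\<close> and
    \<open>g\<close> may list the entries of \<open>A\<close> and \<open>B\<close> along any line of
    \<open>n\<close> cells.\<close>
  have line: "(\<Sum>i = 1..n. int n * (f i - 1) + g i)
      = int n * ((\<Sum>i = 1..n. f i) - int n) + (\<Sum>i = 1..n. g i)" for f g :: "nat \<Rightarrow> int"
    by (simp add: sum.distrib sum_subtractf flip: sum_distrib_left)
  have "row_sum n (square_sum n A B) i = ?s" if "i \<in> {1..n}" for i
    using latin[THEN latin_square_row_sum, OF that]
    unfolding row_sum_def square_sum_def line by simp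
  moreover have "col_sum n (square_sum n A B) j = ?s" if "j \<in> {1..n}" for j
    using latin[THEN latin_square_col_sum, OF that]
    unfolding col_sum_def square_sum_def line by simp
  moreover have "diag_sum n (square_sum n A B) = ?s"
    using assms(2,3) unfolding diag_sum_def square_sum_def line by simp
  moreover have "antidiag_sum n (square_sum n A B) = ?s"
    using assms(4,5) unfolding antidiag_sum_def square_sum_def line by simp
  ultimately show ?thesis
    using square_sum_bij[OF assms(1)] unfolding magic_square_def by blast
qed

end
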